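(* Let $n\ge 1$ and $s$ be integers with $1<f_{n-1}\le s<f_n$, and let $p$ be an integer with $0\le p<f_n$. Then \[ \# P\bigl(\mathring\omega_n,s,\overline{f_{n-1}p}\bigr)= \begin{cases} f_n & (p=0),\\ f_n-(s+1) & (p=1),\\ 0 & (1<p<f_n-1),\\ f_n-(s+1) & (p=f_n-1). \end{cases} \]
   Context: The Fibonacci numbers are $f_0=1$, $f_1=1$, $f_i=f_{i-1}+f_{i-2}$ for $i\ge 2$. For a positive integer $m$ let $[m]=\{1,\dots,m\}$. A word of length $m$ is a map $[m]\to\{0,1\}$, written as a sequence; $x\cdot x'$ denotes concatenation. The Fibonacci words are $\omega_0=(0)$, $\omega_1=(1)$, $\omega_n=\omega_{n-1}\cdot\omega_{n-2}$ for $n\ge2$; $\omega_n$ has length $f_n$. Let $I_n=\mathbb{Z}/f_n\mathbb{Z}$, and let $\overline{i}$ be the class of $i$. The cyclic Fibonacci word $\mathring\omega_n:I_n\to\{0,1\}$ is defined by $\mathring\omega_n(\overline{i})=\omega_n(i)$ for $i\in[f_n]$. For a map $w:I\to\{0,1\}$ with $I=\mathbb{Z}/m\mathbb{Z}$, an integer $s>0$ and $\delta\in I$, let $P(w,s)=\{(\iota,\kappa)\in I\times I : w(\iota+\overline{t-1})=w(\kappa+\overline{t-1}) \text{ for all } t\in[s]\}$ and $P(w,s,\delta)=\{(\iota,\kappa)\in P(w,s):\iota-\kappa=\delta\}$. *)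

theory Defs
  imports "HOL-Number_Theory.Number_Theory" "HOL-Library.Z2"
begin

fun fibo :: "nat \<Rightarrow> nat" where
  "fibo 0 = 1"
| "fibo (Suc 0) = 1"
| "fibo (Suc (Suc i)) = fibo (Suc i) + fibo i"

text \<open>The indexing is shifted by one against the library's Fibonacci numbers.\<close>

lemma fibo_eq_fib: "fibo n = fib (Suc n)"
  by (induction n rule: fibo.induct) simp_all

text \<open>
  A word \<open>[m] \<rightarrow> {0,1}\<close> is a list of length \<open>m\<close> over the type \<^typ>\<open>bit\<close>, used here only as the
  two-element set \<open>{0,1}\<close>. Words are indexed from 1, so the letter at \<open>i \<in> [m]\<close> is
  the list entry at \<open>i - 1\<close>.
\<close>

fun fib_word :: "nat \<Rightarrow> bit list" where
  "fib_word 0 = [0]"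
| "fib_word (Suc 0) = [1]"
| "fib_word (Suc (Suc n)) = fib_word (Suc n) @ fib_word n"

lemma length_fib_word: "length (fib_word n) = fibo n"
  by (induction n rule: fib_word.induct) simp_all

text \<open>
  \<open>\<int>/m\<int>\<close> is the library ring \<^const>\<open>residue_ring\<close>, whose carrier consists of
  the representatives \<open>0, \<dots>, m - 1\<close>; the class of \<open>i\<close> is thus its least nonnegative residue.
\<close>

definition zclass :: "nat \<Rightarrow> int \<Rightarrow> int" where
  "zclass m i = i mod int m"

lemma zclass_in_carrier: "m > 0 \<Longrightarrow> zclass m i \<in> carrier (residue_ring (int m))"
  by (simp add: zclass_def residue_ring_def)

lemma zclass_eq_iff: "zclass m i = zclass m j \<longleftrightarrow> [i = j] (mod int m)"
  by (simp add: zclass_def cong_def)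

text \<open>
  The value at \<open>\<iota>\<close> is the letter of \<open>fib_word n\<close> at the representative of \<open>\<iota>\<close> in
  \<open>{1, \<dots>, f\<^sub>n}\<close> (so at \<open>f\<^sub>n\<close>, not at \<open>0\<close>, for the zero class).
\<close>

definition cyclic_fib_word :: "nat \<Rightarrow> int \<Rightarrow> bit" where
  "cyclic_fib_word n \<iota> = fib_word n ! nat ((\<iota> - 1) mod int (fibo n))"

lemma cyclic_fib_word_zclass:
  assumes "i \<in> {1..fibo n}"
  shows "cyclic_fib_word n (zclass (fibo n) (int i)) = fib_word n ! (i - 1)"
proof -
  have "(zclass (fibo n) (int i) - 1) mod int (fibo n) = int (i - 1)"
    using assms by (simp add: zclass_def mod_diff_left_eq of_nat_diff)
  then show ?thesis
    by (simp add: cyclic_fib_word_def)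
qed

definition P_pairs :: "nat \<Rightarrow> (int \<Rightarrow> bit) \<Rightarrow> nat \<Rightarrow> (int \<times> int) set" where
  "P_pairs m w s =
    {(\<iota>, \<kappa>) \<in> carrier (residue_ring (int m)) \<times> carrier (residue_ring (int m)).
      \<forall>t\<in>{1..s}. w (\<iota> \<oplus>\<^bsub>residue_ring (int m)\<^esub> zclass m (int t - 1))
              = w (\<kappa> \<oplus>\<^bsub>residue_ring (int m)\<^esub> zclass m (int t - 1))}"

definition P_pairs_diff :: "nat \<Rightarrow> (int \<Rightarrow> bit) \<Rightarrow> nat \<Rightarrow> int \<Rightarrow> (int \<times> int) set" where
  "P_pairs_diff m w s \<delta> =
    {(\<iota>, \<kappa>) \<in> P_pairs m w s. \<iota> \<ominus>\<^bsub>residue_ring (int m)\<^esub> \<kappa> = \<delta>}"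

end

theory Submission
  imports Defs
begin

text \<open>
  Write \<open>F = f\<^sub>n\<close> and \<open>G = f\<^sub>n\<^sub>-\<^sub>1\<close>, and let \<open>w\<close> be the cyclic Fibonacci word. The two products
  \<open>\<omega>\<^sub>n\<^sub>-\<^sub>1 \<cdot> \<omega>\<^sub>n\<^sub>-\<^sub>2\<close> and \<open>\<omega>\<^sub>n\<^sub>-\<^sub>2 \<cdot> \<omega>\<^sub>n\<^sub>-\<^sub>1\<close> agree except that their last two letters, which are distinct,
  are exchanged (\<open>fib_word_commute\<close>). The second product is the rotation of the first by \<open>G\<close>, so
  \<open>w x\<close> and \<open>w (x + G)\<close> differ exactly at the two adjacent positions \<open>x = -1, 0\<close>
  (\<open>cyclic_fib_word_flip\<close>). For \<open>p = 1\<close> the windows of length \<open>s\<close> at \<open>\<kappa>\<close> and \<open>\<kappa> + G\<close> therefore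
  coincide iff the window at \<open>\<kappa>\<close> avoids these two positions, which excludes \<open>s + 1\<close> values of
  \<open>\<kappa>\<close>. The case \<open>p = F - 1\<close>, where the shift is \<open>-G\<close>, follows by exchanging the two components.

  For the other \<open>p\<close>, read the word along the progression \<open>e, e + G, e + 2 G, \<dots>\<close>, which visits
  every class since \<open>F\<close> and \<open>G\<close> are coprime. By Cassini's identity \<open>G\<^sup>2 \<equiv> \<plusminus>1\<close>, so the two
  positions of change \<open>-1\<close> and \<open>0\<close> are \<open>e\<close> and \<open>e + G\<^sup>2\<close>, in an order that the sign
  decides, so the changes are exactly \<open>G\<close> steps apart; hence one of the two letters occupies exactly the \<open>G\<close> consecutive steps \<open>1, \<dots>, G\<close>
  (\<open>cyclic_fib_word_arc\<close>). Shifting a cyclic interval of length \<open>G\<close> by \<open>p\<close> steps with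
  \<open>1 < p < F - 1\<close> produces mismatches at two consecutive steps, that is, at two positions \<open>y\<close> and
  \<open>y + G\<close>. These cut the cycle into arcs of lengths \<open>G\<close> and \<open>F - G \<le> G\<close>, so every window of
  length \<open>s \<ge> G\<close> meets one of them (\<open>window_meets\<close>).
\<close>

section \<open>Almost commutation of consecutive Fibonacci words\<close>

text \<open>
  Both products of the next pair of words begin with \<open>\<omega>\<^sub>k\<^sub>+\<^sub>1\<close>, and what remains are the two
  products of the previous pair, in exchanged roles.
\<close>

lemma fib_word_commute:
  "\<exists>u a b. a \<noteq> b \<and> fib_word (Suc k) @ fib_word k = u @ [a, b]
                \<and> fib_word k @ fib_word (Suc k) = u @ [b, a]"
proof (induction k)
  case 0
  show ?case
    by (rule exI[of _ "[]"], rule exI[of _ 1], rule exI[of _ 0]) simp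
next
  case (Suc k)
  then obtain u a b where ab: "a \<noteq> b"
    and IH1: "fib_word (Suc k) @ fib_word k = u @ [a, b]"
    and IH2: "fib_word k @ fib_word (Suc k) = u @ [b, a]"
    by blast
  have "b \<noteq> a \<and> fib_word (Suc (Suc k)) @ fib_word (Suc k) = (fib_word (Suc k) @ u) @ [b, a]
      \<and> fib_word (Suc k) @ fib_word (Suc (Suc k)) = (fib_word (Suc k) @ u) @ [a, b]"
    unfolding fib_word.simps(3) append_assoc using ab by (simp add: IH1 IH2)
  then show ?case
    by blast
qed

section \<open>Arithmetic of Fibonacci numbers\<close>

lemma fibo_pos: "0 < fibo k"
  by (simp add: fibo_eq_fib fib_neq_0_nat)

lemma fibo_le_Suc: "fibo k \<le> fibo (Suc k)"
  by (cases k) simp_all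

lemma coprime_fibo_Suc: "coprime (fibo (Suc k)) (fibo k)"
  using coprime_fib_Suc_nat[of "Suc k"] unfolding fibo_eq_fib by (rule coprime_imp_coprime) simp_all

lemma fibo_Cassini:
  "int (fibo (Suc (Suc k))) * int (fibo k) = int (fibo (Suc k)) ^ 2 + (-1) ^ k"
  using fib_Cassini_int[of "Suc k"] by (simp add: fibo_eq_fib)

section \<open>Letter changes in the cyclic Fibonacci word\<close>

text \<open>
  A map on residue classes is a map on all integers that sees only least residues. This lets the
  windows below be indexed by integer addition instead of the ring operations.
\<close>

definition residue_periodic :: "nat \<Rightarrow> (int \<Rightarrow> bit) \<Rightarrow> bool" where
  "residue_periodic m w \<longleftrightarrow> (\<forall>x. w (x mod int m) = w x)"

lemma residue_periodic_cyclic_fib_word: "residue_periodic (fibo n) (cyclic_fib_word n)"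
  by (simp add: residue_periodic_def cyclic_fib_word_def mod_simps)

lemma residue_periodic_cong:
  "residue_periodic m w \<Longrightarrow> [x = y] (mod int m) \<Longrightarrow> w x = w y"
  unfolding residue_periodic_def cong_def by metis

lemma cyclic_fib_word_cong:
  "[x = y] (mod int (fibo n)) \<Longrightarrow> cyclic_fib_word n x = cyclic_fib_word n y"
  by (rule residue_periodic_cong[OF residue_periodic_cyclic_fib_word])

text \<open>
  Advancing by \<open>G\<close> in the cycle means reading the rotated word \<open>\<omega>\<^sub>n\<^sub>-\<^sub>2 \<cdot> \<omega>\<^sub>n\<^sub>-\<^sub>1\<close>, whose only
  deviation from \<open>\<omega>\<^sub>n\<close> is in the last two letters.
\<close>

lemma cyclic_fib_word_flip:
  fixes k :: nat and x :: int
  defines "n \<equiv> Suc (Suc k)"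
  shows "cyclic_fib_word n (x + int (fibo (Suc k))) \<noteq> cyclic_fib_word n x
           \<longleftrightarrow> int (fibo n) dvd x \<or> int (fibo n) dvd x + 1"
proof -
  obtain u a b where ab: "a \<noteq> b"
    and ut: "fib_word n = u @ [a, b]"
    and us: "fib_word k @ fib_word (Suc k) = u @ [b, a]"
    using fib_word_commute[of k] by (auto simp: n_def)
  define F where "F = fibo n"
  have F: "F = length u + 2"
    using length_fib_word[of n] ut by (simp add: F_def)
  define y where "y = nat ((x - 1) mod int F)"
  have y: "int y = (x - 1) mod int F" "y < F"
    using F by (auto simp: y_def nat_less_iff)
  have "rotate (fibo (Suc k)) (fib_word n) = fib_word k @ fib_word (Suc k)"
    using rotate_append[of "fib_word (Suc k)" "fib_word k"]
    by (simp add: n_def length_fib_word)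
  then have rot: "fib_word n ! ((fibo (Suc k) + y) mod F) = (u @ [b, a]) ! y"
    using nth_rotate[of y "fib_word n" "fibo (Suc k)"] y(2) us
    by (simp add: length_fib_word F_def)
  have "(x + int (fibo (Suc k)) - 1) mod int F = int ((fibo (Suc k) + y) mod F)"
    unfolding zmod_int of_nat_add y(1) by (simp add: mod_simps algebra_simps)
  then have shifted: "cyclic_fib_word n (x + int (fibo (Suc k))) = (u @ [b, a]) ! y"
    using rot by (simp add: cyclic_fib_word_def F_def)
  have "cyclic_fib_word n x = (u @ [a, b]) ! y"
    by (simp add: cyclic_fib_word_def y_def F_def ut)
  with shifted have "cyclic_fib_word n (x + int (fibo (Suc k))) \<noteq> cyclic_fib_word n x
      \<longleftrightarrow> (u @ [b, a]) ! y \<noteq> (u @ [a, b]) ! y"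
    by simp
  also have "\<dots> \<longleftrightarrow> y = F - 1 \<or> y = F - 2"
    using y(2) ab F by (auto simp: nth_append nth_Cons' split: if_splits)
  also have "y = F - 1 \<longleftrightarrow> int F dvd x"
  proof -
    have "y = F - 1 \<longleftrightarrow> (x - 1) mod int F = (-1) mod int F"
      using y F by (simp add: zmod_minus1 flip: y(1))  linarith
    also have "\<dots> \<longleftrightarrow> int F dvd x"
      by (simp add: mod_eq_dvd_iff)
    finally show ?thesis .
  qed
  also have "y = F - 2 \<longleftrightarrow> int F dvd x + 1"
  proof -
    have "(-2) mod int F = (int F - 2) mod int F"
      by (simp add: mod_simps mod_diff_left_eq[symmetric])
    also have "\<dots> = int F - 2"
      using F by (intro mod_pos_pos_trivial) auto
    finally have "y = F - 2 \<longleftrightarrow> (x - 1) mod int F = (-2) mod int F"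
      using y F by (simp flip: y(1))  linarith
    also have "\<dots> \<longleftrightarrow> int F dvd x + 1"
      by (simp add: mod_eq_dvd_iff add.commute)
    finally show ?thesis .
  qed
  finally show ?thesis
    by (simp add: F_def)
qed

lemma bit_eq_if_neq: "a \<noteq> b \<Longrightarrow> c \<noteq> b \<Longrightarrow> a = c" for a b c :: bit
  by (cases a; cases b; cases c) auto

text \<open>
  The steps at which the letter changes along the progression with difference \<open>G\<close> are \<open>0\<close> and
  \<open>G\<close>, provided that the starting point \<open>e\<close> is the one of the two positions \<open>-1\<close>, \<open>0\<close> for
  which \<open>e + G\<^sup>2\<close> is the other.
\<close>

lemma cyclic_fib_word_arc:
  fixes k :: nat
  defines "n \<equiv> Suc (Suc k)"
  defines "F \<equiv> fibo n" and "G \<equiv> fibo (Suc k)"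
  obtains e :: int where
    "\<And>j. j < F \<Longrightarrow>
       cyclic_fib_word n (e + int j * int G) \<noteq> cyclic_fib_word n e \<longleftrightarrow> 1 \<le> j \<and> j \<le> G"
proof -
  define w where "w = cyclic_fib_word n"
  have F: "F = G + fibo k"
    by (simp add: F_def G_def n_def)
  have "int F dvd int G * int G + (-1) ^ k"
    using fibo_Cassini[of k]
    by (metis F_def G_def n_def dvd_triv_left power2_eq_square)
  then have Cassini: "int F dvd int G * int G - 1 \<or> int F dvd int G * int G + 1"
    by (cases "even k") auto
  have "\<exists>e. \<forall>x. w (x + int G) \<noteq> w x \<longleftrightarrow> int F dvd x - e \<or> int F dvd x - (e + int G * int G)"
  proof (cases "int F dvd int G * int G - 1")
    case True
    have "int F dvd x - (-1 + int G * int G) \<longleftrightarrow> int F dvd x" for x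
      using dvd_add_left_iff[OF True, of "x - (-1 + int G * int G)"] by simp
    then show ?thesis
      using cyclic_fib_word_flip[of k]
      by (intro exI[of _ "-1"]) (auto simp: w_def n_def F_def G_def)
  next
    case False
    with Cassini have d: "int F dvd int G * int G + 1" by blast
    have "int F dvd x - (0 + int G * int G) \<longleftrightarrow> int F dvd x + 1" for x
      using dvd_add_left_iff[OF d, of "x - int G * int G"] by (simp add: algebra_simps)
    then show ?thesis
      using cyclic_fib_word_flip[of k]
      by (intro exI[of _ 0]) (auto simp: w_def n_def F_def G_def)
  qed
  then obtain e where
    flip: "\<And>x. w (x + int G) \<noteq> w x \<longleftrightarrow> int F dvd x - e \<or> int F dvd x - (e + int G * int G)"
    by blast
  have cop: "coprime (int F) (int G)"
    using coprime_fibo_Suc[of "Suc k"] by (simp add: F_def G_def n_def del: fibo.simps)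
  have change: "w (e + int (Suc j) * int G) \<noteq> w (e + int j * int G) \<longleftrightarrow> j = 0 \<or> j = G"
    if "j < F" for j
  proof -
    have "e + int (Suc j) * int G = (e + int j * int G) + int G"
      by (simp add: algebra_simps)
    moreover have "int F dvd (e + int j * int G) - e \<longleftrightarrow> j = 0"
      using cop that by (auto simp: coprime_dvd_mult_left_iff dest: zdvd_imp_le)
    moreover have "int F dvd (e + int j * int G) - (e + int G * int G) \<longleftrightarrow> j = G"
    proof -
      have "(e + int j * int G) - (e + int G * int G) = (int j - int G) * int G"
        by (simp add: algebra_simps)
      then have "int F dvd (e + int j * int G) - (e + int G * int G) \<longleftrightarrow> int F dvd int j - int G"
        using cop by (simp add: coprime_dvd_mult_left_iff)
      also have "\<dots> \<longleftrightarrow> j = G"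
        using that F fibo_pos[of k] by (simp flip: mod_eq_dvd_iff)
      finally show ?thesis .
    qed
    ultimately show ?thesis
      using flip[of "e + int j * int G"] by (simp only:)
  qed
  have "0 < G"
    by (simp add: G_def fibo_pos)
  have "j < F \<Longrightarrow> w (e + int j * int G) \<noteq> w e \<longleftrightarrow> 1 \<le> j \<and> j \<le> G" for j
  proof (induction j)
    case (Suc j)
    then have "w (e + int j * int G) \<noteq> w e \<longleftrightarrow> 1 \<le> j \<and> j \<le> G" and "j < F"
      by auto
    with change[of j] \<open>0 < G\<close> show ?case
      using bit_eq_if_neq[of "w (e + int (Suc j) * int G)" "w (e + int j * int G)" "w e"]
      by (cases "j = 0"; cases "j = G") auto
  qed simp
  then show ?thesis
    unfolding w_def by (rule that)
qed

section \<open>Mismatches under a shift\<close>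

text \<open>
  The two positions are \<open>G\<close> apart in one direction round the cycle and \<open>F - G \<le> G\<close> apart in the
  other.
\<close>

lemma window_meets:
  fixes F G s \<kappa> y :: int
  assumes "0 < F" "F \<le> 2 * G" "G \<le> s"
  obtains t where "0 \<le> t" "t < s" "[\<kappa> + t = y] (mod F) \<or> [\<kappa> + t = y + G] (mod F)"
proof -
  define r where "r = (y - \<kappa>) mod F"
  have r: "0 \<le> r" "r < F" "[\<kappa> + r = y] (mod F)"
    using assms(1) by (simp_all add: r_def cong_def mod_simps)
  show thesis
  proof (cases "r < G")
    case True
    then have "r < s"
      using assms(3) by linarith
    with r show ?thesis
      by (intro that[of r] disjI1)
  next
    case False
    \<comment> \<open>The next occurrence of \<open>y\<close> comes too late, but the one of \<open>y + G\<close> in the turn before it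
      lies \<open>F - G\<close> positions earlier.\<close>
    have shifted: "[\<kappa> + (r + G - F) = y + G] (mod F)"
    proof -
      have "[(\<kappa> + r) + (G - F) = y + G] (mod F)"
        using r(3) by (intro cong_add) (simp_all add: cong_iff_dvd_diff)
      then show ?thesis
        by (simp add: algebra_simps)
    qed
    have "0 \<le> r + G - F" "r + G - F < s"
      using r(1,2) assms False by linarith+
    with shifted show ?thesis
      by (intro that[of "r + G - F"] disjI2)
  qed
qed

text \<open>
  Along the progression, the letter at step \<open>0\<close> differs from those at steps \<open>1, \<dots>, G\<close>, and the
  letter at step \<open>-1\<close> equals the one at step \<open>0\<close>. So a shift by \<open>p \<le> G\<close> steps is detected at
  steps \<open>-1\<close> and \<open>0\<close>. For \<open>p > G\<close> the reverse shift by \<open>q = F - p\<close> steps is short, and it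
  moves steps \<open>q - 1\<close> and \<open>q\<close> back to \<open>-1\<close> and \<open>0\<close>.
\<close>

lemma cyclic_fib_word_two_mismatches:
  fixes k p :: nat
  defines "n \<equiv> Suc (Suc k)"
  defines "F \<equiv> fibo n" and "G \<equiv> fibo (Suc k)"
  assumes p: "1 < p" "p < F - 1"
  obtains y where
    "cyclic_fib_word n (y + int G * int p) \<noteq> cyclic_fib_word n y"
    "cyclic_fib_word n (y + int G + int G * int p) \<noteq> cyclic_fib_word n (y + int G)"
proof -
  obtain e where arc: "\<And>j. j < F \<Longrightarrow>
       cyclic_fib_word n (e + int j * int G) \<noteq> cyclic_fib_word n e \<longleftrightarrow> 1 \<le> j \<and> j \<le> G"
    using cyclic_fib_word_arc[of k] unfolding n_def F_def G_def by blast
  define v where "v j = cyclic_fib_word n (e + j * int G)" for j :: int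
  have v_add: "v (i + int F) = v i" for i
    unfolding v_def F_def by (rule cyclic_fib_word_cong) (simp add: cong_iff_dvd_diff algebra_simps)
  have v: "v (int j) \<noteq> v 0 \<longleftrightarrow> 1 \<le> j \<and> j \<le> G" if "j < F" for j
    using arc[OF that] by (simp add: v_def)
  have F: "F = G + fibo k" "fibo k \<le> G"
    using fibo_le_Suc[of k] by (simp_all add: F_def G_def n_def)
  \<comment> \<open>The complement of the arc has \<open>f\<^sub>k\<close> steps, so with two of them it contains step \<open>-1\<close> besides
    step \<open>0\<close>.\<close>
  have "k \<noteq> 0" "k \<noteq> 1"
    using p by (intro notI; simp add: F_def n_def)+
  then have "2 \<le> fibo k"
  proof (cases k rule: fibo.cases)
    case (3 i)
    then show ?thesis using fibo_pos[of i] fibo_pos[of "Suc i"] by simp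
  qed auto
  then have "v (int (F - 1)) = v 0"
    using v[of "F - 1"] F by auto
  then have v_m1: "v (-1) = v 0"
    using v_add[of "-1"] p by (simp add: of_nat_diff)
  note mismatches_at = that
  have steps: thesis if "v (i + int p) \<noteq> v i" "v (i + 1 + int p) \<noteq> v (i + 1)" for i
    using that by (intro mismatches_at[of "e + i * int G"]) (simp_all add: v_def algebra_simps)
  show thesis
  proof (cases "p \<le> G")
    case True
    have "v (int (p - 1)) \<noteq> v 0" "v (int p) \<noteq> v 0"
      using v[of "p - 1"] v[of p] True p by auto
    then show ?thesis
      using steps[of "-1"] v_m1 p by (simp add: of_nat_diff)
  next
    case False
    define q where "q = F - p"
    have q: "1 < q" "q \<le> G" "q < F" "int q = int F - int p"
      using False F p by (auto simp: q_def of_nat_diff)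
    have "v (int (q - 1)) \<noteq> v 0" "v (int q) \<noteq> v 0"
      using v[of "q - 1"] v[of q] q by auto
    moreover have "v (int q - 1 + int p) = v (-1)" "v (int q + int p) = v 0"
      using v_add[of "-1"] v_add[of 0] q(4) by (simp_all add: algebra_simps)
    ultimately show ?thesis
      using steps[of "int q - 1"] v_m1 q(1) by (simp add: of_nat_diff)
  qed
qed

section \<open>Counting pairs of equal windows\<close>

lemma P_pairs_diff_iff:
  fixes w :: "int \<Rightarrow> bit"
  assumes m: "1 < m"
    and w: "residue_periodic m w"
  shows "(\<iota>, \<kappa>) \<in> P_pairs_diff m w s (zclass m d) \<longleftrightarrow>
           \<iota> \<in> {0..<int m} \<and> \<kappa> \<in> {0..<int m} \<and> [\<iota> - \<kappa> = d] (mod int m) \<and>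
           (\<forall>t\<in>{0..<int s}. w (\<iota> + t) = w (\<kappa> + t))"
proof -
  interpret residues "int m" "residue_ring (int m)"
    using m by unfold_locales simp_all
  have "\<iota> \<ominus>\<^bsub>residue_ring (int m)\<^esub> \<kappa> = (\<iota> - \<kappa>) mod int m"
    by (simp add: a_minus_def res_neg_eq res_add_eq mod_simps)
  moreover have "(\<forall>t\<in>{1..s}. w (\<iota> + (int t - 1)) = w (\<kappa> + (int t - 1)))
      \<longleftrightarrow> (\<forall>t\<in>{0..<int s}. w (\<iota> + t) = w (\<kappa> + t))"
  proof -
    have "{0..<int s} = (\<lambda>t. int t - 1) ` {1..s}"
    proof (intro subset_antisym subsetI)
      fix t assume "t \<in> {0..<int s}"
      then show "t \<in> (\<lambda>t. int t - 1) ` {1..s}"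
        by (intro image_eqI[of _ _ "nat (t + 1)"]) auto
    qed auto
    then show ?thesis by simp
  qed
  ultimately show ?thesis
    unfolding P_pairs_diff_def P_pairs_def
    by (auto simp: zclass_def res_carrier_eq res_add_eq mod_simps w[unfolded residue_periodic_def] cong_def)
qed

text \<open>A pair with prescribed difference is determined by its second component.\<close>

lemma card_P_pairs_diff:
  fixes w :: "int \<Rightarrow> bit"
  assumes m: "1 < m"
    and w: "residue_periodic m w"
  shows "card (P_pairs_diff m w s (zclass m d)) =
           card {\<kappa>\<in>{0..<int m}. \<forall>t\<in>{0..<int s}. w (\<kappa> + d + t) = w (\<kappa> + t)}"
    (is "card ?P = card ?K")
proof -
  have "w ((\<kappa> + d) mod int m + t) = w (\<kappa> + d + t)" for \<kappa> t
    by (rule residue_periodic_cong[OF w]) (simp add: cong_def mod_simps)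
  moreover have "\<iota> = (\<kappa> + d) mod int m"
    if "\<iota> \<in> {0..<int m}" "[\<iota> - \<kappa> = d] (mod int m)" for \<iota> \<kappa>
  proof -
    have "[\<iota> = \<kappa> + d] (mod int m)"
      using that(2) by (simp add: cong_iff_dvd_diff algebra_simps)
    then show ?thesis
      using that(1) by (simp add: cong_def)
  qed
  moreover have "(\<kappa> + d) mod int m \<in> {0..<int m}" "[(\<kappa> + d) mod int m - \<kappa> = d] (mod int m)" for \<kappa>
    using m by (auto simp: cong_def mod_simps)
  ultimately have "(\<iota>, \<kappa>) \<in> ?P \<longleftrightarrow> \<kappa> \<in> ?K \<and> \<iota> = (\<kappa> + d) mod int m" for \<iota> \<kappa>
    unfolding P_pairs_diff_iff[OF m w] mem_Collect_eq by metis
  then have "?P = (\<lambda>\<kappa>. ((\<kappa> + d) mod int m, \<kappa>)) ` ?K"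
    by auto
  then show ?thesis
    by (simp add: card_image inj_on_def)
qed

lemma card_P_pairs_diff_minus:
  fixes w :: "int \<Rightarrow> bit"
  assumes m: "1 < m"
    and w: "residue_periodic m w"
  shows "card (P_pairs_diff m w s (zclass m (- d))) = card (P_pairs_diff m w s (zclass m d))"
proof -
  have "[\<kappa> - \<iota> = - d] (mod int m) \<longleftrightarrow> [\<iota> - \<kappa> = d] (mod int m)" for \<iota> \<kappa>
    using cong_minus_minus_iff[of "\<iota> - \<kappa>" d "int m"] by simp
  then have "P_pairs_diff m w s (zclass m (- d)) = prod.swap ` P_pairs_diff m w s (zclass m d)"
    by (auto simp: P_pairs_diff_iff[OF m w] image_iff Bex_def)
  then show ?thesis
    by (simp add: card_image)
qed

text \<open>
  The window at a representative \<open>\<kappa> \<in> {0, \<dots>, F - 1}\<close> avoids both positions of change, which are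
  \<open>0\<close> and \<open>F - 1\<close>, iff it starts after \<open>0\<close> and ends before \<open>F - 1\<close>.
\<close>

lemma card_P_pairs_diff_fibo:
  fixes k s :: nat
  defines "n \<equiv> Suc (Suc k)"
  assumes s: "0 < s" "s < fibo n"
  shows "int (card (P_pairs_diff (fibo n) (cyclic_fib_word n) s
           (zclass (fibo n) (int (fibo (Suc k)))))) = int (fibo n) - (int s + 1)"
proof -
  define F where "F = fibo n"
  define d where "d = int (fibo (Suc k))"
  define w where "w = cyclic_fib_word n"
  have F: "1 < F" "s < F"
    using s by (simp_all add: F_def)
  have w: "residue_periodic F w"
    unfolding w_def F_def by (rule residue_periodic_cyclic_fib_word)
  have flip: "w (\<kappa> + d + t) = w (\<kappa> + t) \<longleftrightarrow> \<not> int F dvd \<kappa> + t \<and> \<not> int F dvd \<kappa> + t + 1" for \<kappa> t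
    using cyclic_fib_word_flip[of k "\<kappa> + t"] by (auto simp: w_def d_def n_def F_def algebra_simps)
  have "{\<kappa>\<in>{0..<int F}. \<forall>t\<in>{0..<int s}. w (\<kappa> + d + t) = w (\<kappa> + t)} = {1..int F - 1 - int s}"
    (is "?K = _")
  proof (intro subset_antisym subsetI)
    fix \<kappa> assume \<kappa>: "\<kappa> \<in> ?K"
    have "\<kappa> \<noteq> 0"
      using \<kappa> s(1) by (auto simp: flip)
    moreover have "\<kappa> < int F - int s"
    proof (rule ccontr)
      assume "\<not> \<kappa> < int F - int s"
      then have le: "int F - 1 - \<kappa> < int s" by simp
      \<comment> \<open>The window reaches the position \<open>F - 1\<close>.\<close>
      have "int F - 1 - \<kappa> \<in> {0..<int s}"
        using \<kappa> le by simp
      then have "\<not> int F dvd \<kappa> + (int F - 1 - \<kappa>) + 1"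
        using \<kappa> unfolding flip by blast
      then show False by simp
    qed
    ultimately show "\<kappa> \<in> {1..int F - 1 - int s}"
      using \<kappa> by auto
  next
    fix \<kappa> assume \<kappa>: "\<kappa> \<in> {1..int F - 1 - int s}"
    have "\<not> int F dvd \<kappa> + t" "\<not> int F dvd \<kappa> + t + 1" if "t \<in> {0..<int s}" for t
      using \<kappa> that by (auto dest!: zdvd_imp_le)
    then show "\<kappa> \<in> ?K"
      using \<kappa> by (auto simp: flip)
  qed
  then have "card (P_pairs_diff F w s (zclass F d)) = card {1..int F - 1 - int s}"
    by (simp add: card_P_pairs_diff[OF F(1) w])
  then show ?thesis
    using F(2) by (simp add: F_def w_def d_def)
qed

lemma card_P_pairs_diff_fibo_mult:
  fixes k s p :: nat
  defines "n \<equiv> Suc (Suc k)"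
  assumes s: "fibo (Suc k) \<le> s" and p: "1 < p" "p < fibo n - 1"
  shows "card (P_pairs_diff (fibo n) (cyclic_fib_word n) s
           (zclass (fibo n) (int (fibo (Suc k)) * int p))) = 0"
proof -
  define F where "F = fibo n"
  define G where "G = fibo (Suc k)"
  define w where "w = cyclic_fib_word n"
  have m: "1 < F"
    using p by (simp add: F_def)
  have w: "residue_periodic F w"
    unfolding w_def F_def by (rule residue_periodic_cyclic_fib_word)
  note w_cong = residue_periodic_cong[OF w]
  obtain y where y: "w (y + int G * int p) \<noteq> w y" "w (y + int G + int G * int p) \<noteq> w (y + int G)"
    using cyclic_fib_word_two_mismatches[of p k] p unfolding w_def n_def G_def by blast
  have F: "int F \<le> 2 * int G" "0 < int F" "int G \<le> int s"
    using fibo_le_Suc[of k] m s by (simp_all add: F_def G_def n_def)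
  have "\<exists>t\<in>{0..<int s}. w (\<kappa> + int G * int p + t) \<noteq> w (\<kappa> + t)" for \<kappa>
  proof -
    obtain t where t: "0 \<le> t" "t < int s"
      "[\<kappa> + t = y] (mod int F) \<or> [\<kappa> + t = y + int G] (mod int F)"
      using window_meets[OF F(2,1,3)] .
    have transfer: "w (\<kappa> + int G * int p + t) \<noteq> w (\<kappa> + t)"
      if "[\<kappa> + t = z] (mod int F)" "w (z + int G * int p) \<noteq> w z" for z
    proof -
      have "[\<kappa> + int G * int p + t = z + int G * int p] (mod int F)"
        using cong_add[OF that(1) cong_refl[of "int G * int p"]] by (simp add: algebra_simps)
      then show ?thesis
        using w_cong w_cong[OF that(1)] that(2) by metis
    qed
    show ?thesis
      using t transfer y by (intro bexI[of _ t]) auto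
  qed
  then have "{\<kappa>\<in>{0..<int F}. \<forall>t\<in>{0..<int s}. w (\<kappa> + int G * int p + t) = w (\<kappa> + t)} = {}"
    by blast
  then have "card (P_pairs_diff F w s (zclass F (int G * int p))) = 0"
    unfolding card_P_pairs_diff[OF m w] by (simp only: card.empty)
  then show ?thesis
    by (simp add: F_def w_def G_def)
qed

theorem theorem2p5:
  fixes n s p :: nat
  assumes "n \<ge> 1"
    and "1 < fibo (n - 1)"
    and "fibo (n - 1) \<le> s"
    and "s < fibo n"
    and "p < fibo n"
  defines "N \<equiv> int (card (P_pairs_diff (fibo n) (cyclic_fib_word n) s
                      (zclass (fibo n) (int (fibo (n - 1)) * int p))))"
  shows "(p = 0 \<longrightarrow> N = int (fibo n))
       \<and> (p = 1 \<longrightarrow> N = int (fibo n) - (int s + 1))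
       \<and> (1 < p \<and> int p < int (fibo n) - 1 \<longrightarrow> N = 0)
       \<and> (int p = int (fibo n) - 1 \<longrightarrow> N = int (fibo n) - (int s + 1))"
proof -
  have "n \<noteq> 0" "n \<noteq> 1"
    using assms(1,2) by auto
  then obtain k where n: "n = Suc (Suc k)"
    by (metis One_nat_def not0_implies_Suc)
  have s: "0 < s" "1 < fibo n" "fibo (Suc k) \<le> s" "n - 1 = Suc k"
    using assms(2-4) n by auto
  note w = residue_periodic_cyclic_fib_word[of n]
  note one = card_P_pairs_diff_fibo[of s k, folded n, OF s(1) assms(4)]
  have "N = int (fibo n)" if "p = 0"
    unfolding N_def card_P_pairs_diff[OF s(2) w] using that by (simp del: atLeastLessThan_iff)
  moreover have "N = int (fibo n) - (int s + 1)" if "p = 1"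
    unfolding N_def s(4) using one that by simp
  moreover have "N = 0" if "1 < p" "int p < int (fibo n) - 1"
    using card_P_pairs_diff_fibo_mult[of k s p] s(3) that by (simp add: N_def n)
  moreover have "N = int (fibo n) - (int s + 1)" if "int p = int (fibo n) - 1"
  proof -
    have "zclass (fibo n) (int (fibo (n - 1)) * int p) = zclass (fibo n) (- int (fibo (Suc k)))"
      unfolding that s(4) by (simp add: zclass_eq_iff cong_iff_dvd_diff algebra_simps)
    then show ?thesis
      using one card_P_pairs_diff_minus[OF s(2) w] by (simp add: N_def)
  qed
  ultimately show ?thesis
    by blast
qed

end
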